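(* Let $n\ge 4$. (1) Every eigenvalue $\mu$ of $\mathcal{Q}(n)$ satisfies $\mu\ge -4$. (2) $-4$ is an eigenvalue of $\mathcal{Q}(n)$ if and only if there exists a vector $X=(x_{(i,j)})_{(i,j)\in[n]^2}\in\mathbb{R}^{n^2}\setminus\{\mathbf{0}\}$ such that (a) $\sum_{j=1}^n x_{(k,j)}=0$ and $\sum_{i=1}^n x_{(i,k)}=0$ for every $k\in[n]$; (b) $\sum_{i+j=k+2} x_{(i,j)}=0$ for every $k\in[2n-3]$; (c) $\sum_{i-j=k+1-n} x_{(i,j)}=0$ for every $k\in[2n-3]$; (d) $x_{(1,1)}=x_{(1,n)}=x_{(n,1)}=x_{(n,n)}=0$. In the positive case, $X$ is an eigenvector associated with the eigenvalue $-4$.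
   Context: The $n$-Queens' graph $\mathcal{Q}(n)$ has vertex set $[n]^2=\{1,\dots,n\}^2$ (the squares $(i,j)$ of an $n\times n$ chessboard, row $i$ and column $j$); two distinct vertices $(i,j),(p,q)$ are adjacent iff $i=p$, or $j=q$, or $i+j=p+q$, or $i-j=p-q$. Eigenvalues of a graph are those of its adjacency matrix; sums in (b), (c) range over $(i,j)\in[n]^2$. *)

theory Defs
  imports
    "Graph_Theory.Pair_Digraph"
    "Jordan_Normal_Form.Char_Poly"
begin

definition board :: "nat \<Rightarrow> (nat \<times> nat) set" where
  "board n = {1..n} \<times> {1..n}"

(* Differences of coordinates are taken in int, since subtraction on nat truncates. *)
definition queens_adjacent :: "nat \<times> nat \<Rightarrow> nat \<times> nat \<Rightarrow> bool" where
  "queens_adjacent s t \<longleftrightarrow> s \<noteq> t \<and>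
     (fst s = fst t \<or> snd s = snd t \<or> fst s + snd s = fst t + snd t \<or>
      int (fst s) - int (snd s) = int (fst t) - int (snd t))"

(* A simple graph is represented by its symmetric, irreflexive set of arcs. *)
definition queens_graph :: "nat \<Rightarrow> (nat \<times> nat) pair_pre_digraph" where
  "queens_graph n =
     \<lparr>pverts = board n,
      parcs = {(s, t). s \<in> board n \<and> t \<in> board n \<and> queens_adjacent s t}\<rparr>"

lemma pair_graph_queens_graph: "pair_graph (queens_graph n)"
proof
  let ?A = "{(s, t). s \<in> board n \<and> t \<in> board n \<and> queens_adjacent s t}"
  have "queens_adjacent t s" if "queens_adjacent s t" for s t
    using that unfolding queens_adjacent_def by metis
  then have "sym ?A"
    by (auto intro: symI)
  then show "symmetric (with_proj (queens_graph n))"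
    by (simp add: symmetric_def queens_graph_def)
  show "finite (pverts (queens_graph n))"
    by (simp add: queens_graph_def board_def)
  have "?A \<subseteq> board n \<times> board n" by blast
  then show "finite (parcs (queens_graph n))"
    by (simp add: queens_graph_def board_def finite_subset)
qed (auto simp: queens_graph_def queens_adjacent_def)

(* Vectors and matrices are indexed by 0, ..., n^2 - 1; the squares are enumerated
   row by row: square n is the enumeration and square_index n its inverse. *)
definition square :: "nat \<Rightarrow> nat \<Rightarrow> nat \<times> nat" where
  "square n a = (a div n + 1, a mod n + 1)"

definition square_index :: "nat \<Rightarrow> nat \<times> nat \<Rightarrow> nat" where
  "square_index n s = (fst s - 1) * n + (snd s - 1)"

lemma square_square_index:
  assumes "s \<in> board n"
  shows "square n (square_index n s) = s"
proof -
  obtain i j where s: "s = (Suc i, Suc j)" "i < n" "j < n"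
    using assms by (cases s; cases "fst s"; cases "snd s") (auto simp: board_def)
  then show ?thesis by (simp add: square_def square_index_def)
qed

lemma square_index_square: "square_index n (square n a) = a"
  by (simp add: square_def square_index_def)

lemma square_index_less:
  assumes "s \<in> board n"
  shows "square_index n s < n\<^sup>2"
proof -
  obtain i j where s: "s = (i, j)" by (cases s)
  have ij: "1 \<le> i" "i \<le> n" "1 \<le> j" "j \<le> n" using assms by (auto simp: s board_def)
  have "(i - 1) * n + (j - 1) < (i - 1) * n + n" using ij by simp
  also have "\<dots> = i * n" using ij by (cases i) auto
  also have "\<dots> \<le> n * n" using ij by simp
  finally show ?thesis by (simp add: s square_index_def power2_eq_square)
qed

lemma square_in_board:
  assumes "a < n\<^sup>2"
  shows "square n a \<in> board n"
proof -
  have "0 < n" using assms by (cases n) auto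
  moreover have "a div n < n" using assms by (simp add: power2_eq_square less_mult_imp_div_less)
  ultimately show ?thesis by (auto simp: square_def board_def Suc_le_eq)
qed

lemma bij_betw_square: "bij_betw (square n) {..<n\<^sup>2} (board n)"
  by (rule bij_betwI[where g = "square_index n"])
    (auto simp: square_in_board square_index_less square_square_index square_index_square)

definition queens_adjacency_matrix :: "nat \<Rightarrow> real mat" where
  "queens_adjacency_matrix n =
     mat (n\<^sup>2) (n\<^sup>2)
       (\<lambda>(a, b). if (square n a, square n b) \<in> parcs (queens_graph n) then 1 else 0)"

definition entry :: "nat \<Rightarrow> real vec \<Rightarrow> nat \<Rightarrow> nat \<Rightarrow> real" where
  "entry n X i j = X $ square_index n (i, j)"

(* For n >= 2 the sums in the second conjunct run over all antidiagonals, and those in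
   the third over all diagonals, that have at least two squares; 2 * n - 3 is a
   subtraction on nat, used only for n >= 4. *)
definition queens_conditions :: "nat \<Rightarrow> real vec \<Rightarrow> bool" where
  "queens_conditions n X \<longleftrightarrow>
     (\<forall>k\<in>{1..n}. (\<Sum>j = 1..n. entry n X k j) = 0 \<and> (\<Sum>i = 1..n. entry n X i k) = 0) \<and>
     (\<forall>k\<in>{1..2 * n - 3}.
        (\<Sum>(i, j)\<in>{(i, j) \<in> board n. i + j = k + 2}. entry n X i j) = 0) \<and>
     (\<forall>k\<in>{1..2 * n - 3}.
        (\<Sum>(i, j)\<in>{(i, j) \<in> board n. int i - int j = int k + 1 - int n}. entry n X i j) = 0) \<and>
     entry n X 1 1 = 0 \<and> entry n X 1 n = 0 \<and> entry n X n 1 = 0 \<and> entry n X n n = 0"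

end

theory Submission imports Defs begin

text \<open>
  Distinct squares lie on at most one common line (row, column, diagonal or antidiagonal),
  and every square lies on exactly four lines. So, with \<open>A\<close> the adjacency matrix,
  \<open>(A + 4 I) x\<close> is, at each square, the total of the sums of \<open>x\<close> over the four lines through it, and
  the quadratic form of \<open>A + 4 I\<close> is the sum of the squares of all line sums. It is therefore
  nonnegative, and vanishes exactly when all line sums do; the diagonals and antidiagonals
  of length one account for the corner conditions.
\<close>

text \<open>Coefficients of the linear forms i, j, i + j and i - j, hence normals rather than
  direction vectors: the level sets are, in this order, rows, columns, antidiagonals and
  diagonals.\<close>

definition directions :: "(int \<times> int) set" where
  "directions = {(1, 0), (0, 1), (1, 1), (1, -1)}"

text \<open>The lines in direction \<open>d\<close> are the level sets of \<open>line_label d\<close>.\<close>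

definition line_label :: "int \<times> int \<Rightarrow> nat \<times> nat \<Rightarrow> int" where
  "line_label d s = fst d * int (fst s) + snd d * int (snd s)"

definition line_sum :: "nat \<Rightarrow> (nat \<times> nat \<Rightarrow> real) \<Rightarrow> int \<times> int \<Rightarrow> int \<Rightarrow> real" where
  "line_sum n x d k = (\<Sum>t | t \<in> board n \<and> line_label d t = k. x t)"

lemma finite_directions [simp]: "finite directions"
  by (simp add: directions_def)

lemma finite_board [simp]: "finite (board n)"
  by (simp add: board_def)

lemma sum_directions:
  "(\<Sum>d\<in>directions. f d) = f (1, 0) + f (0, 1) + f (1, 1) + f (1, -1)"
  for f :: "int \<times> int \<Rightarrow> 'a::comm_monoid_add"
  by (simp add: directions_def add.assoc)

text \<open>Any two of the four forms are linearly independent, so distinct squares agree in at most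
  one of them, and in one exactly when a queen's move joins them. A square agrees with itself in all
  four, whence the 4. This is the entry of A + 4 I at \<open>(s, t)\<close>.\<close>

lemma common_lines:
  "(\<Sum>d\<in>directions. if line_label d t = line_label d s then 1 else 0) =
   (if queens_adjacent s t then 1 else 0) + (if t = s then 4 else (0::real))"
proof -
  obtain i j p q where [simp]: "s = (i, j)" "t = (p, q)" by (cases s; cases t)
  show ?thesis
    unfolding sum_directions
    by (simp add: line_label_def queens_adjacent_def)
qed

lemma line_sum_outside:
  assumes "\<And>t. t \<in> board n \<Longrightarrow> line_label d t \<noteq> k"
  shows "line_sum n x d k = 0"
proof -
  have "{t. t \<in> board n \<and> line_label d t = k} = {}" using assms by auto
  then show ?thesis by (simp only: line_sum_def sum.empty)
qed

lemma adjacency_mult: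
  assumes v: "v \<in> carrier_vec (n\<^sup>2)" and s: "s \<in> board n"
  defines "x \<equiv> \<lambda>t. v $ square_index n t"
  shows "(queens_adjacency_matrix n *\<^sub>v v) $ square_index n s + 4 * x s =
    (\<Sum>d\<in>directions. line_sum n x d (line_label d s))"
proof -
  have idx: "square_index n s < n\<^sup>2" using s by (rule square_index_less)
  have "(queens_adjacency_matrix n *\<^sub>v v) $ square_index n s =
      (\<Sum>b<n\<^sup>2. (if (s, square n b) \<in> parcs (queens_graph n) then 1 else 0) * v $ b)"
    using idx v s
    by (simp add: queens_adjacency_matrix_def scalar_prod_def lessThan_atLeast0
        square_square_index)
  \<comment> \<open>Every term becomes a function of \<open>square n b\<close>, so that the
    enumeration can be removed by reindexing.\<close>
  also have "\<dots> = (\<Sum>b<n\<^sup>2. (if queens_adjacent s (square n b) then 1 else 0) * x (square n b))"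
    using s by (intro sum.cong)
      (auto simp: queens_graph_def square_in_board x_def square_index_square)
  also have "\<dots> = (\<Sum>t\<in>board n. (if queens_adjacent s t then 1 else 0) * x t)"
    by (rule sum.reindex_bij_betw[OF bij_betw_square])
  finally have mult: "(queens_adjacency_matrix n *\<^sub>v v) $ square_index n s =
    (\<Sum>t\<in>board n. (if queens_adjacent s t then 1 else 0) * x t)" .
  \<comment> \<open>The diagonal term, spread over the board, supplies the second summand of
    \<open>common_lines\<close>.\<close>
  have "4 * x s = (\<Sum>t\<in>board n. (if t = s then 4 else 0) * x t)"
    using s by (simp add: if_distrib[of "\<lambda>c. c * _"] cong: if_cong)
  with mult have "(queens_adjacency_matrix n *\<^sub>v v) $ square_index n s + 4 * x s =
      (\<Sum>t\<in>board n. (\<Sum>d\<in>directions. if line_label d t = line_label d s then 1 else 0) * x t)"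
    by (simp add: common_lines distrib_right sum.distrib)
  also have "\<dots> = (\<Sum>d\<in>directions. \<Sum>t\<in>board n. if line_label d t = line_label d s then x t else 0)"
    by (simp add: sum_distrib_right sum.swap[of _ _ "board n"] if_distrib[of "\<lambda>c. c * _"]
        cong: if_cong)
  also have "\<dots> = (\<Sum>d\<in>directions. line_sum n x d (line_label d s))"
    by (simp add: line_sum_def sum.inter_filter)
  finally show ?thesis .
qed

text \<open>The second factor is constant on each line; grouping the squares by label leaves each
  line sum multiplied by itself.\<close>

lemma sum_mult_line_sum:
  "(\<Sum>s\<in>board n. x s * line_sum n x d (line_label d s)) =
   (\<Sum>k\<in>line_label d ` board n. (line_sum n x d k)\<^sup>2)"
proof -
  have "(\<Sum>s\<in>board n. x s * line_sum n x d (line_label d s)) =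
    (\<Sum>k\<in>line_label d ` board n. \<Sum>s | s \<in> board n \<and> line_label d s = k.
      x s * line_sum n x d (line_label d s))"
    by (rule sum.image_gen) simp
  also have "\<dots> = (\<Sum>k\<in>line_label d ` board n. (line_sum n x d k)\<^sup>2)"
    by (intro sum.cong) (simp_all add: power2_eq_square sum_distrib_right line_sum_def)
  finally show ?thesis .
qed

text \<open>For an eigenvector the left side of \<open>adjacency_mult\<close> is (\<mu> + 4)
  \<open>x s\<close>; multiply by \<open>x s\<close> and sum over the board.\<close>

lemma eigenvector_quadratic_form:
  assumes "eigenvector (queens_adjacency_matrix n) v \<mu>"
  defines "x \<equiv> \<lambda>t. v $ square_index n t"
  shows "(\<mu> + 4) * (\<Sum>s\<in>board n. (x s)\<^sup>2) =
    (\<Sum>d\<in>directions. \<Sum>k\<in>line_label d ` board n. (line_sum n x d k)\<^sup>2)"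
proof -
  have v: "v \<in> carrier_vec (n\<^sup>2)"
    and ev: "queens_adjacency_matrix n *\<^sub>v v = \<mu> \<cdot>\<^sub>v v"
    using assms by (auto simp: eigenvector_def queens_adjacency_matrix_def)
  have "(\<mu> + 4) * x s = (\<Sum>d\<in>directions. line_sum n x d (line_label d s))"
    if "s \<in> board n" for s
    using adjacency_mult[OF v that] v square_index_less[OF that]
    by (simp add: ev x_def distrib_right)
  then have "(\<Sum>s\<in>board n. x s * ((\<mu> + 4) * x s)) =
    (\<Sum>s\<in>board n. x s * (\<Sum>d\<in>directions. line_sum n x d (line_label d s)))"
    by simp
  also have "\<dots> = (\<Sum>d\<in>directions. \<Sum>s\<in>board n. x s * line_sum n x d (line_label d s))"
    by (simp add: sum_distrib_left sum.swap[of _ _ "board n"])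
  finally show ?thesis
    by (simp add: sum_mult_line_sum sum_distrib_left power2_eq_square mult_ac)
qed

lemma board_norm_pos:
  assumes "v \<in> carrier_vec (n\<^sup>2)" "v \<noteq> 0\<^sub>v (n\<^sup>2)"
  shows "(\<Sum>s\<in>board n. (v $ square_index n s)\<^sup>2) > (0::real)"
proof -
  obtain a where a: "a < n\<^sup>2" "v $ a \<noteq> 0"
    using assms by (metis carrier_vecD eq_vecI index_zero_vec)
  show ?thesis
    by (rule sum_pos2[where i = "square n a"])
      (use a in \<open>auto simp: square_in_board square_index_square\<close>)
qed

lemma eigenvalue_ge:
  assumes "eigenvalue (queens_adjacency_matrix n) \<mu>"
  shows "\<mu> \<ge> -4"
proof -
  obtain v where v: "eigenvector (queens_adjacency_matrix n) v \<mu>"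
    using assms by (auto simp: eigenvalue_def)
  then have "(\<Sum>s\<in>board n. (v $ square_index n s)\<^sup>2) > 0"
    by (intro board_norm_pos) (auto simp: eigenvector_def queens_adjacency_matrix_def)
  moreover have "0 \<le> (\<mu> + 4) * (\<Sum>s\<in>board n. (v $ square_index n s)\<^sup>2)"
    unfolding eigenvector_quadratic_form[OF v] by (intro sum_nonneg zero_le_power2)
  ultimately show ?thesis
    by (simp add: zero_le_mult_iff)
qed

text \<open>At \<mu> = -4 the quadratic form vanishes, and with it each of its squares. The converse
  needs only \<open>adjacency_mult\<close>, read square by square.\<close>

lemma eigenvector_iff_line_sums:
  assumes v: "v \<in> carrier_vec (n\<^sup>2)" and nz: "v \<noteq> 0\<^sub>v (n\<^sup>2)"
  shows "eigenvector (queens_adjacency_matrix n) v (-4) \<longleftrightarrow>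
    (\<forall>d\<in>directions. \<forall>k. line_sum n (\<lambda>t. v $ square_index n t) d k = 0)"
    (is "_ \<longleftrightarrow> (\<forall>d\<in>_. \<forall>k. line_sum n ?x d k = 0)")
proof
  assume "eigenvector (queens_adjacency_matrix n) v (-4)"
  from eigenvector_quadratic_form[OF this]
  have "(\<Sum>d\<in>directions. \<Sum>k\<in>line_label d ` board n. (line_sum n ?x d k)\<^sup>2) = 0"
    by simp
  then have "\<forall>d\<in>directions. (\<Sum>k\<in>line_label d ` board n. (line_sum n ?x d k)\<^sup>2) = 0"
    by (subst (asm) sum_nonneg_eq_0_iff) (auto intro: sum_nonneg)
  then have zero: "line_sum n ?x d k = 0" if "d \<in> directions" "k \<in> line_label d ` board n" for d k
    using that sum_nonneg_eq_0_iff[of "line_label d ` board n" "\<lambda>k. (line_sum n ?x d k)\<^sup>2"]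
    by auto
  \<comment> \<open>The quadratic form sees only labels attained on the board; any other label gives
    an empty sum.\<close>
  have "line_sum n ?x d k = 0" if "d \<in> directions" for d k
  proof (cases "k \<in> line_label d ` board n")
    case False
    then show ?thesis by (intro line_sum_outside) blast
  qed (rule zero[OF that])
  then show "\<forall>d\<in>directions. \<forall>k. line_sum n ?x d k = 0" by blast
next
  assume zero: "\<forall>d\<in>directions. \<forall>k. line_sum n ?x d k = 0"
  have "queens_adjacency_matrix n *\<^sub>v v = -4 \<cdot>\<^sub>v v"
  proof (rule eq_vecI)
    fix a assume "a < dim_vec (-4 \<cdot>\<^sub>v v)"
    then have a: "a < n\<^sup>2" using v by simp
    from adjacency_mult[OF v square_in_board[OF a]] zero
    show "(queens_adjacency_matrix n *\<^sub>v v) $ a = (-4 \<cdot>\<^sub>v v) $ a"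
      using a v by (simp add: square_index_square)
  qed (use v in \<open>simp add: queens_adjacency_matrix_def\<close>)
  then show "eigenvector (queens_adjacency_matrix n) v (-4)"
    using v nz by (simp add: eigenvector_def queens_adjacency_matrix_def)
qed

lemma line_sum_singleton:
  assumes "\<And>t. t \<in> board n \<and> line_label d t = k \<longleftrightarrow> t = s"
  shows "line_sum n x d k = x s"
  by (simp add: line_sum_def assms)

text \<open>Antidiagonal labels run from 2 to 2n and diagonal labels from 1 - n to n - 1. The
  extreme labels belong to the corners; the shifts k + 2 and k + 1 - n with k in 1..2n-3 reach
  exactly the labels in between.\<close>

lemma line_sums_zero_iff:
  assumes n: "n \<ge> 2"
  shows "(\<forall>d\<in>directions. \<forall>k. line_sum n (\<lambda>t. X $ square_index n t) d k = 0) \<longleftrightarrow>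
    queens_conditions n X"
    (is "(\<forall>d\<in>_. \<forall>k. ?L d k = 0) \<longleftrightarrow> _")
proof -
  have row: "?L (1, 0) (int k) = (\<Sum>j = 1..n. entry n X k j)" if "k \<in> {1..n}" for k
    unfolding line_sum_def entry_def
    by (rule sum.reindex_bij_witness[where i = "\<lambda>j. (k, j)" and j = snd])
      (use that in \<open>auto simp: line_label_def board_def\<close>)
  have col: "?L (0, 1) (int k) = (\<Sum>i = 1..n. entry n X i k)" if "k \<in> {1..n}" for k
    unfolding line_sum_def entry_def
    by (rule sum.reindex_bij_witness[where i = "\<lambda>i. (i, k)" and j = fst])
      (use that in \<open>auto simp: line_label_def board_def\<close>)
  have anti: "?L (1, 1) (int k + 2) =
      (\<Sum>(i, j)\<in>{(i, j) \<in> board n. i + j = k + 2}. entry n X i j)" for k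
    unfolding line_sum_def entry_def
    by (intro sum.cong) (auto simp: line_label_def)
  have diag: "?L (1, -1) (int k + 1 - int n) =
      (\<Sum>(i, j)\<in>{(i, j) \<in> board n. int i - int j = int k + 1 - int n}. entry n X i j)" for k
    unfolding line_sum_def entry_def
    by (intro sum.cong) (auto simp: line_label_def)
  have c11: "?L (1, 1) 2 = entry n X 1 1" unfolding entry_def
    by (rule line_sum_singleton) (use n in \<open>auto simp: line_label_def board_def\<close>)
  have cnn: "?L (1, 1) (2 * int n) = entry n X n n" unfolding entry_def
    by (rule line_sum_singleton) (use n in \<open>auto simp: line_label_def board_def\<close>)
  have c1n: "?L (1, -1) (1 - int n) = entry n X 1 n" unfolding entry_def
    by (rule line_sum_singleton) (use n in \<open>auto simp: line_label_def board_def\<close>)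
  have cn1: "?L (1, -1) (int n - 1) = entry n X n 1" unfolding entry_def
    by (rule line_sum_singleton) (use n in \<open>auto simp: line_label_def board_def\<close>)
  show ?thesis
  proof
    assume "\<forall>d\<in>directions. \<forall>k. ?L d k = 0"
    then have zero: "?L (1, 0) k = 0" "?L (0, 1) k = 0" "?L (1, 1) k = 0" "?L (1, -1) k = 0" for k
      by (simp_all add: directions_def)
    \<comment> \<open>Rows and columns are treated first because \<open>row\<close> and
      \<open>col\<close> hold only for \<open>k\<close> in 1..n, whereas \<open>anti\<close> and
      \<open>diag\<close> are unconditional and can be folded back inside the conditions.\<close>
    have "(\<Sum>j = 1..n. entry n X k j) = 0" "(\<Sum>i = 1..n. entry n X i k) = 0"
      if "k \<in> {1..n}" for k
      using row[OF that] col[OF that] zero by simp_all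
    then show "queens_conditions n X"
      unfolding queens_conditions_def anti[symmetric] diag[symmetric]
        c11[symmetric] cnn[symmetric] c1n[symmetric] cn1[symmetric]
      using zero by blast
  next
    assume cond: "queens_conditions n X"
    then have anti_zero: "?L (1, 1) (int m + 2) = 0"
      and diag_zero: "?L (1, -1) (int m + 1 - int n) = 0" if "m \<in> {1..2 * n - 3}" for m
      unfolding anti diag queens_conditions_def using that by blast+
    have "?L (1, 0) k = 0" for k
    proof (cases "k \<in> int ` {1..n}")
      case True
      then show ?thesis using cond row by (auto simp: queens_conditions_def)
    qed (rule line_sum_outside, auto simp: line_label_def board_def)
    moreover have "?L (0, 1) k = 0" for k
    proof (cases "k \<in> int ` {1..n}")
      case True
      then show ?thesis using cond col by (auto simp: queens_conditions_def)
    qed (rule line_sum_outside, auto simp: line_label_def board_def)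
    moreover have "?L (1, 1) k = 0" for k
    proof -
      \<comment> \<open>The cases are: no square, the corner (1,1), the corner (n,n), and the
        antidiagonals of length at least two.\<close>
      consider "k < 2 \<or> k > 2 * int n" | "k = 2" | "k = 2 * int n"
        | "3 \<le> k" "k \<le> 2 * int n - 1" by linarith
      then show ?thesis
      proof cases
        case 1
        then show ?thesis
          by (intro line_sum_outside) (auto simp: line_label_def board_def)
      next
        case 4
        then have "nat (k - 2) \<in> {1..2 * n - 3}" "k = int (nat (k - 2)) + 2" by auto
        then show ?thesis using anti_zero by metis
      qed (use cond c11 cnn in \<open>simp_all add: queens_conditions_def\<close>)
    qed
    moreover have "?L (1, -1) k = 0" for k
    proof -
      consider "k < 1 - int n \<or> k > int n - 1" | "k = 1 - int n" | "k = int n - 1"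
        | "2 - int n \<le> k" "k \<le> int n - 2" by linarith
      then show ?thesis
      proof cases
        case 1
        then show ?thesis
          by (intro line_sum_outside) (auto simp: line_label_def board_def)
      next
        case 4
        \<comment> \<open>This inverts the shift k + 1 - n; the bounds on \<open>k\<close> make the
          argument of \<open>nat\<close> positive, so nothing is truncated.\<close>
        then have "nat (k + int n - 1) \<in> {1..2 * n - 3}"
          "k = int (nat (k + int n - 1)) + 1 - int n" by auto
        then show ?thesis using diag_zero by metis
      qed (use cond c1n cn1 in \<open>simp_all add: queens_conditions_def\<close>)
    qed
    ultimately show "\<forall>d\<in>directions. \<forall>k. ?L d k = 0"
      by (simp add: directions_def)
  qed
qed

theorem theorem8:
  fixes n :: nat
  assumes "n \<ge> 4"
  shows "(\<forall>\<mu>. eigenvalue (queens_adjacency_matrix n) \<mu> \<longrightarrow> \<mu> \<ge> -4) \<and>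
    (eigenvalue (queens_adjacency_matrix n) (-4) \<longleftrightarrow>
      (\<exists>X \<in> carrier_vec (n\<^sup>2). X \<noteq> 0\<^sub>v (n\<^sup>2) \<and> queens_conditions n X)) \<and>
    (\<forall>X \<in> carrier_vec (n\<^sup>2). X \<noteq> 0\<^sub>v (n\<^sup>2) \<and> queens_conditions n X \<longrightarrow>
      eigenvector (queens_adjacency_matrix n) X (-4))"
proof -
  \<comment> \<open>Stated for every \<open>X\<close>, this gives both the existence criterion and
    the final claim about eigenvectors.\<close>
  have "eigenvector (queens_adjacency_matrix n) X (-4) \<longleftrightarrow>
      X \<in> carrier_vec (n\<^sup>2) \<and> X \<noteq> 0\<^sub>v (n\<^sup>2) \<and> queens_conditions n X" for X
    using eigenvector_iff_line_sums[of X n] line_sums_zero_iff[of n X] assms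
    by (auto simp: eigenvector_def queens_adjacency_matrix_def)
  then show ?thesis
    using eigenvalue_ge by (auto simp: eigenvalue_def)
qed

end
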